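(* Let $G$ be a graph with $E(G)\neq\varnothing$. The following conditions are equivalent: (i) For every pseudoultrametrizable weight $w:E(G)\to\mathbb{R}^+$ the poset $(\mathfrak{U}_w,\preceq)$ contains the least pseudoultrametric $\rho_{0,w}$, i.e., $\rho_{0,w}\in\mathfrak{U}_w$ and $\rho_{0,w}(u,v)\le\rho(u,v)$ for every $\rho\in\mathfrak{U}_w$ and all $u,v\in V(G)$; (ii) $G$ is a complete $k$-partite graph with $k\ge 2$. If condition (ii) holds and $w$ is a pseudoultrametrizable weight, then for all $u\neq v$ in $V(G)$ we have $$\rho_{0,w}(u,v)=\begin{cases}0&\text{if }\{u,v\}\in\mathrm{TM},\\ \max_{e\in E(F)}w(e)&\text{if }\{u,v\}\notin\mathrm{TM},\end{cases}$$ where $F$ is an arbitrary path from $\mathfrak{P}_{u,v}$ for which $\max_{e\in E(F)}w(e)$ is achieved on a single edge.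
   Context: A graph $G=(V(G),E(G))$ has a nonempty (possibly infinite) vertex set $V(G)$, and its edge set $E(G)$ (possibly empty) is a set of unordered pairs of distinct vertices. A path is a finite graph with at least one edge whose vertices can be enumerated without repetition as $v_1,\dots,v_n$ so that $\{v_i,v_j\}$ is an edge iff $|i-j|=1$; it connects $v_1$ and $v_n$. For distinct $u,v\in V(G)$, $\mathfrak{P}_{u,v}$ is the set of paths in $G$ (subgraphs of $G$, not necessarily induced) connecting $u$ and $v$. A weight on $G$ is a function $w:E(G)\to\mathbb{R}^+=[0,+\infty)$. For an arbitrary cardinal number $k$ (finite or infinite), $G$ is $k$-partite if $V(G)$ can be decomposed into $k$ nonempty pairwise disjoint sets (parts) such that the two ends of every edge lie in distinct parts; it is complete $k$-partite if moreover every two vertices in distinct parts are adjacent. A pseudoultrametric on a set $X$ is a function $d:X\times X\to\mathbb{R}^+$ with $d(x,y)=d(y,x)$, $d(x,x)=0$ and $d(x,y)\le\max\{d(x,z),d(z,y)\}$ for all $x,y,z\in X$. A pseudoultrametric $d$ on $V(G)$ extends $w$ if $d(x,y)=w(\{x,y\})$ for every $\{x,y\}\in E(G)$. $\mathfrak{U}_w$ is the set of all pseudoultrametrics on $V(G)$ extending $w$; $w$ is pseudoultrametrizable if $\mathfrak{U}_w\ne\varnothing$. The order is pointwise: $\rho_1\preceq\rho_2$ iff $\rho_1(x,y)\le\rho_2(x,y)$ for all $x,y\in V(G)$. For a weight $w$, $\mathrm{TM}$ (twice-max) is the set of unordered pairs $\{p,q\}$ of distinct nonadjacent vertices of $G$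 such that each path $P\in\mathfrak{P}_{p,q}$ contains at least two distinct edges $e_1,e_2$ with $w(e_1)=w(e_2)=\max_{e\in E(P)}w(e)$. *)

theory Defs
  imports Complex_Main "HOL-Library.Disjoint_Sets"
begin

unbundle cardinal_syntax

record 'a graph =
  verts :: "'a set"
  edges :: "'a set set"

definition is_graph :: "'a graph \<Rightarrow> bool" where
  "is_graph G \<longleftrightarrow> verts G \<noteq> {} \<and>
     edges G \<subseteq> {{u, v} | u v. u \<in> verts G \<and> v \<in> verts G \<and> u \<noteq> v}"

definition is_subgraph :: "'a graph \<Rightarrow> 'a graph \<Rightarrow> bool" where
  "is_subgraph H G \<longleftrightarrow> is_graph H \<and> verts H \<subseteq> verts G \<and> edges H \<subseteq> edges G"

definition path_enumeration :: "'a graph \<Rightarrow> 'a list \<Rightarrow> bool" where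
  "path_enumeration P vs \<longleftrightarrow> distinct vs \<and> set vs = verts P \<and>
     (\<forall>i < length vs. \<forall>j < length vs.
        {vs ! i, vs ! j} \<in> edges P \<longleftrightarrow> \<bar>int i - int j\<bar> = 1)"

definition connecting_path :: "'a graph \<Rightarrow> 'a \<Rightarrow> 'a \<Rightarrow> bool" where
  "connecting_path P u v \<longleftrightarrow> is_graph P \<and> finite (verts P) \<and> edges P \<noteq> {} \<and>
     (\<exists>vs. path_enumeration P vs \<and> hd vs = u \<and> last vs = v)"

definition paths :: "'a graph \<Rightarrow> 'a \<Rightarrow> 'a \<Rightarrow> 'a graph set" where
  "paths G u v = {P. is_subgraph P G \<and> connecting_path P u v}"

(* The number of parts k is an arbitrary cardinal, finite or infinite,
   represented as a cardinal order. *)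
definition partite_decomposition :: "'k rel \<Rightarrow> 'a graph \<Rightarrow> 'a set set \<Rightarrow> bool" where
  "partite_decomposition k G \<P> \<longleftrightarrow> Card_order k \<and> partition_on (verts G) \<P> \<and> |\<P>| =o k \<and>
     (\<forall>u v. {u, v} \<in> edges G \<longrightarrow> (\<forall>A\<in>\<P>. \<not> (u \<in> A \<and> v \<in> A)))"

definition complete_partite :: "'k rel \<Rightarrow> 'a graph \<Rightarrow> bool" where
  "complete_partite k G \<longleftrightarrow> (\<exists>\<P>. partite_decomposition k G \<P> \<and>
     (\<forall>A\<in>\<P>. \<forall>B\<in>\<P>. A \<noteq> B \<longrightarrow> (\<forall>u\<in>A. \<forall>v\<in>B. {u, v} \<in> edges G)))"

(* Weights and pseudoultrametrics are total functions of which only the values on edges,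
   respectively on pairs of points of the carrier, are relevant. *)
definition is_weight :: "'a graph \<Rightarrow> ('a set \<Rightarrow> real) \<Rightarrow> bool" where
  "is_weight G w \<longleftrightarrow> (\<forall>e\<in>edges G. 0 \<le> w e)"

definition pseudoultrametric_on :: "'a set \<Rightarrow> ('a \<Rightarrow> 'a \<Rightarrow> real) \<Rightarrow> bool" where
  "pseudoultrametric_on X d \<longleftrightarrow>
     (\<forall>x\<in>X. \<forall>y\<in>X. 0 \<le> d x y) \<and>
     (\<forall>x\<in>X. \<forall>y\<in>X. d x y = d y x) \<and>
     (\<forall>x\<in>X. d x x = 0) \<and>
     (\<forall>x\<in>X. \<forall>y\<in>X. \<forall>z\<in>X. d x y \<le> max (d x z) (d z y))"

definition extends_weight :: "'a graph \<Rightarrow> ('a set \<Rightarrow> real) \<Rightarrow> ('a \<Rightarrow> 'a \<Rightarrow> real) \<Rightarrow> bool" where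
  "extends_weight G w d \<longleftrightarrow> (\<forall>x y. {x, y} \<in> edges G \<longrightarrow> d x y = w {x, y})"

definition pseudoultrametric_extensions ::
    "'a graph \<Rightarrow> ('a set \<Rightarrow> real) \<Rightarrow> ('a \<Rightarrow> 'a \<Rightarrow> real) set" where
  "pseudoultrametric_extensions G w =
     {d. pseudoultrametric_on (verts G) d \<and> extends_weight G w d}"

definition pseudoultrametrizable :: "'a graph \<Rightarrow> ('a set \<Rightarrow> real) \<Rightarrow> bool" where
  "pseudoultrametrizable G w \<longleftrightarrow> pseudoultrametric_extensions G w \<noteq> {}"

definition pointwise_le_on :: "'a set \<Rightarrow> ('a \<Rightarrow> 'a \<Rightarrow> real) \<Rightarrow> ('a \<Rightarrow> 'a \<Rightarrow> real) \<Rightarrow> bool" where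
  "pointwise_le_on X \<rho>\<^sub>1 \<rho>\<^sub>2 \<longleftrightarrow> (\<forall>x\<in>X. \<forall>y\<in>X. \<rho>\<^sub>1 x y \<le> \<rho>\<^sub>2 x y)"

definition is_least_extension ::
    "'a graph \<Rightarrow> ('a set \<Rightarrow> real) \<Rightarrow> ('a \<Rightarrow> 'a \<Rightarrow> real) \<Rightarrow> bool" where
  "is_least_extension G w \<rho> \<longleftrightarrow> \<rho> \<in> pseudoultrametric_extensions G w \<and>
     (\<forall>\<rho>' \<in> pseudoultrametric_extensions G w. pointwise_le_on (verts G) \<rho> \<rho>')"

definition max_weight :: "('a set \<Rightarrow> real) \<Rightarrow> 'a graph \<Rightarrow> real" where
  "max_weight w P = Max (w ` edges P)"

definition twice_max :: "'a graph \<Rightarrow> ('a set \<Rightarrow> real) \<Rightarrow> 'a set set" where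
  "twice_max G w = {{p, q} | p q. p \<in> verts G \<and> q \<in> verts G \<and> p \<noteq> q \<and> {p, q} \<notin> edges G \<and>
     (\<forall>P \<in> paths G p q. \<exists>e\<^sub>1 \<in> edges P. \<exists>e\<^sub>2 \<in> edges P.
        e\<^sub>1 \<noteq> e\<^sub>2 \<and> w e\<^sub>1 = max_weight w P \<and> w e\<^sub>2 = max_weight w P)}"

definition max_on_single_edge :: "('a set \<Rightarrow> real) \<Rightarrow> 'a graph \<Rightarrow> bool" where
  "max_on_single_edge w P \<longleftrightarrow> (\<exists>!e. e \<in> edges P \<and> w e = max_weight w P)"

end

theory Submission
  imports Defs
begin

text \<open>
  Everything turns on one observation: \<open>G\<close> is complete multipartite exactly when
  non-adjacency is transitive on the vertices, the parts then being its classes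
  (\<open>complete_partite_iff_nonadjacency_trans\<close>).

  If non-adjacency is not transitive, there are an edge \<open>{u, x}\<close> and a vertex \<open>v\<close> adjacent to
  neither end. Give every edge the weight 1. The discrete metric with \<open>u\<close> and \<open>v\<close> identified,
  and the one with \<open>v\<close> and \<open>x\<close> identified, both extend this weight. A least extension would lie
  below both, hence vanish on the pairs \<open>u, v\<close> and \<open>v, x\<close>, and then also on the edge \<open>{u, x}\<close>
  (\<open>least_imp_nonadjacency_trans\<close>).

  If non-adjacency is transitive, start with any extension \<open>d\<close> and set \<open>d u v\<close> to 0 for every
  pair of twins, which are non-adjacent vertices with the same distances to all their (common)
  neighbours. For other pairs, the value is the same in all extensions: either
  \<open>{u, v}\<close> is an edge, or some common neighbour \<open>x\<close> satisfies \<open>d u x \<noteq> d x v\<close> and the isosceles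
  property of ultrametrics gives \<open>d u v = max (d u x) (d x v)\<close>. Twinship is an equivalence
  relation compatible with these forced values, so the result is a pseudoultrametric, and
  it is the least one (\<open>least_extension_collapse\<close>).

  For the formula, the isosceles property extends from triangles to paths: a path whose
  maximal weight sits on a single edge forces the distance of its ends to be this maximum
  (\<open>extension_eq_max_weight\<close>). If instead \<open>{u, v}\<close> is a twice-max pair, then the two-edge
  paths already show that \<open>u\<close> and \<open>v\<close> are twins, so the least extension vanishes there.
\<close>

section \<open>Pseudoultrametrics\<close>

lemma pseudoultrametric_onD:
  assumes "pseudoultrametric_on X d" "x \<in> X" "y \<in> X"
  shows "0 \<le> d x y" "d x y = d y x" "d x x = 0" "z \<in> X \<Longrightarrow> d x y \<le> max (d x z) (d z y)"
  using assms unfolding pseudoultrametric_on_def by blast+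

lemma isosceles:
  assumes "pseudoultrametric_on X d" "x \<in> X" "y \<in> X" "z \<in> X" "d x z \<noteq> d z y"
  shows "d x y = max (d x z) (d z y)"
proof -
  have "d x y \<le> max (d x z) (d z y)" "d x z \<le> max (d x y) (d y z)" "d z y \<le> max (d z x) (d x y)"
    and "d y z = d z y" "d z x = d x z"
    using pseudoultrametric_onD[OF assms(1)] assms(2-4) by blast+
  then show ?thesis using assms(5) by linarith
qed

text \<open>
  By the strong triangle inequality the distance of two points of a chain is at most the
  largest step between them. Stating this for a downward closed property \<open>Q\<close> covers the
  bounds \<open>\<lambda>r. r \<le> c\<close> and \<open>\<lambda>r. r < c\<close> at once.
\<close>

lemma chain_distance:
  fixes p :: "nat \<Rightarrow> 'a"
  assumes d: "pseudoultrametric_on X d"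
    and Q: "Q 0" "\<And>r s. r \<le> s \<Longrightarrow> Q s \<Longrightarrow> Q r"
    and p: "\<And>k. i \<le> k \<Longrightarrow> k \<le> j \<Longrightarrow> p k \<in> X"
    and step: "\<And>k. i \<le> k \<Longrightarrow> k < j \<Longrightarrow> Q (d (p k) (p (Suc k)))"
    and "i \<le> j"
  shows "Q (d (p i) (p j))"
  using \<open>i \<le> j\<close> p step
proof (induction j rule: dec_induct)
  case base
  then show ?case using Q(1) pseudoultrametric_onD(3)[OF d] by simp
next
  case (step n)
  have "Q (d (p i) (p n))" using step by simp
  moreover have "Q (d (p n) (p (Suc n)))" using step by simp
  moreover have "d (p i) (p (Suc n)) \<le> max (d (p i) (p n)) (d (p n) (p (Suc n)))"
    using step by (intro pseudoultrametric_onD(4)[OF d]) auto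
  ultimately show ?case using Q(2) by (metis max_def)
qed

section \<open>Paths\<close>

definition path_graph :: "'a list \<Rightarrow> 'a graph" where
  "path_graph vs = \<lparr>verts = set vs, edges = {{vs ! i, vs ! Suc i} | i. Suc i < length vs}\<rparr>"

lemma path_graph_in_paths:
  assumes G: "is_graph G" and vs: "distinct vs" "2 \<le> length vs" "set vs \<subseteq> verts G"
    and adj: "\<And>i. Suc i < length vs \<Longrightarrow> {vs ! i, vs ! Suc i} \<in> edges G"
  shows "path_graph vs \<in> paths G (hd vs) (last vs)"
proof -
  have "path_enumeration (path_graph vs) vs"
    unfolding path_enumeration_def
  proof (intro conjI allI impI)
    fix i j assume ij: "i < length vs" "j < length vs"
    have "{vs ! i, vs ! j} \<in> edges (path_graph vs) \<longleftrightarrow> j = Suc i \<or> i = Suc j"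
      using ij vs(1) unfolding path_graph_def
      by (auto simp: doubleton_eq_iff nth_eq_iff_index_eq)
    then show "{vs ! i, vs ! j} \<in> edges (path_graph vs) \<longleftrightarrow> \<bar>int i - int j\<bar> = 1"
      by auto
  qed (use vs in \<open>auto simp: path_graph_def\<close>)
  moreover have "is_graph (path_graph vs)"
  proof -
    have "vs ! i \<noteq> vs ! Suc i" if "Suc i < length vs" for i
      using that vs(1) by (simp add: nth_eq_iff_index_eq)
    then show ?thesis
      using vs(2) by (fastforce simp: is_graph_def path_graph_def)
  qed
  moreover have "edges (path_graph vs) \<noteq> {}"
    using vs(2) by (auto simp: path_graph_def intro!: exI[of _ 0])
  ultimately show ?thesis
    using vs(3) adj unfolding paths_def connecting_path_def is_subgraph_def
    by (auto simp: path_graph_def)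
qed

lemma edge_path:
  assumes "is_graph G" "{u, v} \<in> edges G" "u \<in> verts G" "v \<in> verts G" "u \<noteq> v"
  obtains P where "P \<in> paths G u v" "edges P = {{u, v}}"
proof
  show "path_graph [u, v] \<in> paths G u v"
    using path_graph_in_paths[of G "[u, v]"] assms by (simp add: less_Suc_eq)
  show "edges (path_graph [u, v]) = {{u, v}}"
    by (auto simp: path_graph_def)
qed

lemma two_edge_path:
  assumes "is_graph G" "{u, x} \<in> edges G" "{x, v} \<in> edges G" "u \<in> verts G" "x \<in> verts G"
    "v \<in> verts G" "u \<noteq> x" "x \<noteq> v" "u \<noteq> v"
  obtains P where "P \<in> paths G u v" "edges P = {{u, x}, {x, v}}"
proof
  show "path_graph [u, x, v] \<in> paths G u v"
  proof -
    have "{[u, x, v] ! i, [u, x, v] ! Suc i} \<in> edges G" if "Suc i < length [u, x, v]" for i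
    proof -
      have "i = 0 \<or> i = 1" using that by auto
      then show ?thesis using assms by auto
    qed
    then show ?thesis
      using path_graph_in_paths[of G "[u, x, v]"] assms by simp
  qed
  have "{i. Suc i < length [u, x, v]} = {0, 1}" by auto
  then have "edges (path_graph [u, x, v]) = (\<lambda>i. {[u, x, v] ! i, [u, x, v] ! Suc i}) ` {0, 1}"
    unfolding path_graph_def graph.select_convs by blast
  then show "edges (path_graph [u, x, v]) = {{u, x}, {x, v}}"
    by simp
qed

lemma edges_path_enumeration:
  assumes "path_enumeration P vs" "is_graph P"
  shows "edges P = {{vs ! i, vs ! Suc i} | i. Suc i < length vs}"
proof (intro equalityI subsetI)
  fix e assume "e \<in> edges P"
  then obtain a b where e: "e = {a, b}" "a \<in> set vs" "b \<in> set vs"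
    using assms unfolding is_graph_def path_enumeration_def by blast
  then obtain i j where ij: "a = vs ! i" "b = vs ! j" "i < length vs" "j < length vs"
    by (auto simp: in_set_conv_nth)
  then have "\<bar>int i - int j\<bar> = 1"
    using assms(1) \<open>e \<in> edges P\<close> e unfolding path_enumeration_def by auto
  then have "j = Suc i \<or> i = Suc j" by linarith
  then show "e \<in> {{vs ! i, vs ! Suc i} | i. Suc i < length vs}"
    using e ij by blast
next
  fix e assume "e \<in> {{vs ! i, vs ! Suc i} | i. Suc i < length vs}"
  then show "e \<in> edges P"
    using assms(1) unfolding path_enumeration_def by auto
qed

text \<open>
  The isosceles property for paths. If the maximum \<open>m > 0\<close> is attained only on the edge
  \<open>{a, b}\<close>, then \<open>a\<close> is closer than \<open>m\<close> to one end of the path and \<open>b\<close> to the other, so the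
  ends are at distance at least \<open>d a b = m\<close>.
\<close>

lemma extension_eq_max_weight:
  assumes d: "d \<in> pseudoultrametric_extensions G w"
    and F: "F \<in> paths G u v" "max_on_single_edge w F"
  shows "d u v = max_weight w F"
proof -
  have pd: "pseudoultrametric_on (verts G) d" and ext: "extends_weight G w d"
    using d unfolding pseudoultrametric_extensions_def by auto
  have FG: "is_graph F" "verts F \<subseteq> verts G" "edges F \<subseteq> edges G" "finite (verts F)"
    using F unfolding paths_def is_subgraph_def connecting_path_def by auto
  obtain vs where enum: "path_enumeration F vs" and ends: "hd vs = u" "last vs = v"
    using F unfolding paths_def connecting_path_def by auto
  have dist: "distinct vs" and vsF: "set vs = verts F" using enum unfolding path_enumeration_def by auto
  have "vs \<noteq> []" using FG(1) vsF unfolding is_graph_def by auto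
  define n where "n = length vs - 1"
  have len: "length vs = Suc n" using \<open>vs \<noteq> []\<close> by (simp add: n_def)
  have uv: "u = vs ! 0" "v = vs ! n"
    using ends \<open>vs \<noteq> []\<close> by (auto simp: hd_conv_nth last_conv_nth n_def)
  have edgesF: "edges F = {{vs ! i, vs ! Suc i} | i. Suc i < length vs}"
    using edges_path_enumeration enum FG(1) by blast
  have "finite (edges F)"
  proof (rule finite_subset)
    show "edges F \<subseteq> Pow (verts F)" using FG(1) unfolding is_graph_def by auto
  qed (use FG(4) in simp)
  define m where "m = max_weight w F"
  have le_m: "w e \<le> m" if "e \<in> edges F" for e
    unfolding m_def max_weight_def using that \<open>finite (edges F)\<close> by simp
  have inG: "vs ! i \<in> verts G" if "i \<le> n" for i
    using that vsF FG(2) len nth_mem[of i vs] by auto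
  have edge_i: "{vs ! i, vs ! Suc i} \<in> edges F" if "i < n" for i
    using edgesF that len by auto
  have step: "d (vs ! i) (vs ! Suc i) = w {vs ! i, vs ! Suc i}" if "i < n" for i
    using ext FG(3) edge_i[OF that] unfolding extends_weight_def by auto
  obtain e where e: "e \<in> edges F" "w e = m" and uniq: "\<And>e'. e' \<in> edges F \<Longrightarrow> w e' = m \<Longrightarrow> e' = e"
    using F(2) unfolding max_on_single_edge_def m_def by auto
  obtain i where i: "i < n" "e = {vs ! i, vs ! Suc i}" using e(1) edgesF len by auto
  have less: "d (vs ! k) (vs ! Suc k) < m" if k: "k < n" "k \<noteq> i" for k
  proof -
    have "{vs ! k, vs ! Suc k} \<noteq> e"
      using k i len dist by (auto simp: doubleton_eq_iff nth_eq_iff_index_eq)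
    then have "w {vs ! k, vs ! Suc k} \<noteq> m" using uniq edge_i[OF k(1)] by blast
    then show ?thesis using le_m[OF edge_i[OF k(1)]] step[OF k(1)] by simp
  qed
  have dm: "d (vs ! i) (vs ! Suc i) = m" using step i e by simp
  have m0: "0 \<le> m" using dm pseudoultrametric_onD(1)[OF pd inG inG, of i "Suc i"] i by simp
  have upper: "d u v \<le> m"
    unfolding uv
  proof (rule chain_distance[OF pd, where Q = "\<lambda>r. r \<le> m"])
    show "d (vs ! k) (vs ! Suc k) \<le> m" if "0 \<le> k" "k < n" for k
      using le_m[OF edge_i[OF that(2)]] step[OF that(2)] by simp
  qed (use m0 inG in auto)
  have inV: "u \<in> verts G" "v \<in> verts G" "vs ! i \<in> verts G" "vs ! Suc i \<in> verts G"
    using inG i uv by auto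
  (* Either end of the path may lie on the edge e, and then its distance to that end of e is 0,
     which is below m only if m is positive. *)
  have "m \<le> d u v"
  proof (cases "m = 0")
    case True
    then show ?thesis using pseudoultrametric_onD(1)[OF pd] inV by simp
  next
    case False
    then have "0 < m" using m0 by simp
    then have "d u (vs ! i) < m" "d (vs ! Suc i) v < m"
      unfolding uv
      by (rule chain_distance[OF pd, where Q = "\<lambda>r. r < m"], use less inG i in auto)+
    moreover have "d (vs ! i) (vs ! Suc i) \<le> max (d (vs ! i) u) (d u (vs ! Suc i))"
      "d u (vs ! Suc i) \<le> max (d u v) (d v (vs ! Suc i))"
      "d (vs ! i) u = d u (vs ! i)" "d v (vs ! Suc i) = d (vs ! Suc i) v"
      using pseudoultrametric_onD[OF pd] inV by blast+
    ultimately show ?thesis using dm by linarith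
  qed
  then show ?thesis using upper m_def by simp
qed

section \<open>Complete multipartite graphs and non-adjacency\<close>

definition nonadjacency :: "'a graph \<Rightarrow> ('a \<times> 'a) set" where
  "nonadjacency G = {(u, v). u \<in> verts G \<and> v \<in> verts G \<and> {u, v} \<notin> edges G}"

lemma edgeD:
  assumes "is_graph G" "{u, v} \<in> edges G"
  shows "u \<in> verts G" "v \<in> verts G" "u \<noteq> v"
proof -
  obtain a b where "{u, v} = {a, b}" "a \<in> verts G" "b \<in> verts G" "a \<noteq> b"
    using assms unfolding is_graph_def by blast
  then show "u \<in> verts G" "v \<in> verts G" "u \<noteq> v" by (auto simp: doubleton_eq_iff)
qed

lemma complete_partite_nonadjacency_trans:
  assumes "complete_partite k G"
  shows "trans (nonadjacency G)"
proof -
  obtain \<P> where part: "partition_on (verts G) \<P>"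
    and indep: "\<And>u v A. {u, v} \<in> edges G \<Longrightarrow> A \<in> \<P> \<Longrightarrow> \<not> (u \<in> A \<and> v \<in> A)"
    and compl: "\<And>A B u v. A \<in> \<P> \<Longrightarrow> B \<in> \<P> \<Longrightarrow> A \<noteq> B \<Longrightarrow> u \<in> A \<Longrightarrow> v \<in> B \<Longrightarrow> {u, v} \<in> edges G"
    using assms unfolding complete_partite_def partite_decomposition_def by metis
  have same: "(u, v) \<in> nonadjacency G \<longleftrightarrow> (\<exists>A\<in>\<P>. u \<in> A \<and> v \<in> A)" for u v
  proof
    assume uv: "(u, v) \<in> nonadjacency G"
    then have "u \<in> \<Union>\<P>" "v \<in> \<Union>\<P>"
      using part by (auto simp: nonadjacency_def partition_on_def)
    then obtain A B where AB: "A \<in> \<P>" "B \<in> \<P>" "u \<in> A" "v \<in> B" by blast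
    moreover have "A = B"
      using compl[OF AB(1,2) _ AB(3,4)] uv by (auto simp: nonadjacency_def)
    ultimately show "\<exists>A\<in>\<P>. u \<in> A \<and> v \<in> A" by blast
  next
    assume "\<exists>A\<in>\<P>. u \<in> A \<and> v \<in> A"
    then show "(u, v) \<in> nonadjacency G"
      using part indep[of u v] by (auto simp: nonadjacency_def partition_on_def)
  qed
  show ?thesis
  proof (rule transI)
    fix u v x assume "(u, v) \<in> nonadjacency G" "(v, x) \<in> nonadjacency G"
    then obtain A B where AB: "A \<in> \<P>" "u \<in> A" "v \<in> A" "B \<in> \<P>" "v \<in> B" "x \<in> B"
      unfolding same by blast
    then have "A = B" using part unfolding partition_on_def disjoint_def by blast
    then show "(u, x) \<in> nonadjacency G" unfolding same using AB by blast
  qed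
qed

text \<open>
  The parts are the classes of non-adjacency; the two ends of any edge witness that there are
  at least two of them.
\<close>

lemma nonadjacency_trans_complete_partite:
  fixes G :: "'a graph"
  assumes G: "is_graph G" "edges G \<noteq> {}" and tr: "trans (nonadjacency G)"
  shows "\<exists>k :: 'a set rel. ctwo \<le>o k \<and> complete_partite k G"
proof -
  let ?N = "nonadjacency G"
  define \<P> where "\<P> = verts G // ?N"
  have eq: "equiv (verts G) ?N"
  proof (rule equivI)
    show "refl_on (verts G) ?N"
      using edgeD(3)[OF G(1), of x x for x] unfolding refl_on_def nonadjacency_def by auto
    show "sym ?N" unfolding sym_def nonadjacency_def by (auto simp: insert_commute)
  qed (use tr in \<open>auto simp: nonadjacency_def\<close>)
  have part: "partition_on (verts G) \<P>"
    unfolding \<P>_def by (rule partition_on_quotient[OF eq])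
  have class_eq: "(u, v) \<in> ?N" if "A \<in> \<P>" "u \<in> A" "v \<in> A" for A u v
    using that eq unfolding \<P>_def by (meson quotient_eq_iff)
  have class_neq: "A = B" if "A \<in> \<P>" "B \<in> \<P>" "u \<in> A" "v \<in> B" "(u, v) \<in> ?N" for A B u v
    using that eq unfolding \<P>_def by (meson quotient_eq_iff)
  obtain u v where uv: "{u, v} \<in> edges G"
    using G unfolding is_graph_def by blast
  note uvV = edgeD[OF G(1) uv]
  have "|UNIV :: bool set| \<le>o |\<P>|"
  proof (rule card_of_ordLeqI[where f = "\<lambda>b. if b then ?N `` {u} else ?N `` {v}"])
    have "?N `` {u} \<noteq> ?N `` {v}"
      unfolding eq_equiv_class_iff[OF eq uvV(1,2)] using uv by (simp add: nonadjacency_def)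
    then show "inj_on (\<lambda>b. if b then ?N `` {u} else ?N `` {v}) UNIV"
      by (auto simp: inj_on_def)
  qed (use uvV in \<open>auto simp: \<P>_def quotientI\<close>)
  moreover have "complete_partite (card_of \<P>) G"
    unfolding complete_partite_def partite_decomposition_def
  proof (intro exI[of _ \<P>] conjI ballI impI allI)
    show "Card_order |\<P>|" "|\<P>| =o |\<P>|" by (simp_all only: card_of_Card_order ordIso_refl)
    show "\<not> (u \<in> A \<and> v \<in> A)" if "{u, v} \<in> edges G" "A \<in> \<P>" for u v A
      using class_eq that unfolding nonadjacency_def by auto
    show "{u, v} \<in> edges G" if "A \<in> \<P>" "B \<in> \<P>" "A \<noteq> B" "u \<in> A" "v \<in> B" for A B u v
      using class_neq[OF that(1,2,4,5)] that part
      unfolding nonadjacency_def partition_on_def by auto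
  qed (rule part)
  ultimately show ?thesis unfolding ctwo_def by blast
qed

lemma complete_partite_iff_nonadjacency_trans:
  fixes G :: "'a graph"
  assumes "is_graph G" "edges G \<noteq> {}"
  shows "(\<exists>k :: 'a set rel. ctwo \<le>o k \<and> complete_partite k G) \<longleftrightarrow> trans (nonadjacency G)"
  using nonadjacency_trans_complete_partite[OF assms] complete_partite_nonadjacency_trans by blast

section \<open>Least extensions force transitive non-adjacency\<close>

text \<open>
  Identifying two non-adjacent vertices destroys no edge, so the discrete metric pulled back
  along the map that sends \<open>q\<close> to \<open>p\<close> still extends the constant weight 1.
\<close>

lemma discrete_identified_extension:
  assumes G: "is_graph G" and pq: "{p, q} \<notin> edges G"
  shows "(\<lambda>a b. if (id(q := p)) a = (id(q := p)) b then 0 else 1)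
    \<in> pseudoultrametric_extensions G (\<lambda>_. 1)"
proof -
  have "(id(q := p)) x \<noteq> (id(q := p)) y" if xy: "{x, y} \<in> edges G" for x y
  proof
    assume "(id(q := p)) x = (id(q := p)) y"
    then have "x = y \<or> {x, y} = {p, q}" by (auto split: if_splits)
    then show False using xy pq edgeD(3)[OF G xy] by metis
  qed
  then show ?thesis
    unfolding pseudoultrametric_extensions_def pseudoultrametric_on_def extends_weight_def by simp
qed

lemma least_imp_nonadjacency_trans:
  assumes G: "is_graph G"
    and least: "\<forall>w. is_weight G w \<and> pseudoultrametrizable G w \<longrightarrow> (\<exists>\<rho>. is_least_extension G w \<rho>)"
  shows "trans (nonadjacency G)"
proof (rule transI, rule ccontr)
  fix u v x
  assume uv: "(u, v) \<in> nonadjacency G" and vx: "(v, x) \<in> nonadjacency G"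
    and ux: "(u, x) \<notin> nonadjacency G"
  have V: "u \<in> verts G" "v \<in> verts G" "x \<in> verts G" and edge: "{u, x} \<in> edges G"
    using uv vx ux by (auto simp: nonadjacency_def)
  define \<delta> :: "'a \<Rightarrow> 'a \<Rightarrow> 'a \<Rightarrow> 'a \<Rightarrow> real"
    where "\<delta> p q = (\<lambda>a b. if (id(q := p)) a = (id(q := p)) b then 0 else 1)" for p q
  have ext: "\<delta> p q \<in> pseudoultrametric_extensions G (\<lambda>_. 1)" if "(p, q) \<in> nonadjacency G" for p q
    using that discrete_identified_extension[OF G, of p q]
    unfolding \<delta>_def nonadjacency_def by auto
  have "is_weight G (\<lambda>_. 1)" by (simp add: is_weight_def)
  moreover have "pseudoultrametrizable G (\<lambda>_. 1)"
    using ext[OF uv] by (auto simp: pseudoultrametrizable_def)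
  ultimately obtain \<rho> where \<rho>: "is_least_extension G (\<lambda>_. 1) \<rho>"
    using least by blast
  have "\<rho> u v \<le> \<delta> u v u v" "\<rho> v x \<le> \<delta> v x v x"
    using \<rho> ext[OF uv] ext[OF vx] V unfolding is_least_extension_def pointwise_le_on_def by blast+
  then have "\<rho> u v \<le> 0" "\<rho> v x \<le> 0" by (simp_all add: \<delta>_def split: if_splits)
  moreover have pd: "pseudoultrametric_on (verts G) \<rho>" and "extends_weight G (\<lambda>_. 1) \<rho>"
    using \<rho> unfolding is_least_extension_def pseudoultrametric_extensions_def by auto
  then have "\<rho> u x = 1" using edge unfolding extends_weight_def by blast
  moreover have "\<rho> u x \<le> max (\<rho> u v) (\<rho> v x)"
    by (rule pseudoultrametric_onD(4)[OF pd V(1,3,2)])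
  ultimately show False by simp
qed

section \<open>The least extension of a complete multipartite graph\<close>

definition twins :: "'a graph \<Rightarrow> ('a \<Rightarrow> 'a \<Rightarrow> real) \<Rightarrow> 'a \<Rightarrow> 'a \<Rightarrow> bool" where
  "twins G d u v \<longleftrightarrow> (u, v) \<in> nonadjacency G \<and>
     (\<forall>x. {u, x} \<in> edges G \<longrightarrow> {v, x} \<in> edges G \<longrightarrow> d u x = d v x)"

definition collapse_twins :: "'a graph \<Rightarrow> ('a \<Rightarrow> 'a \<Rightarrow> real) \<Rightarrow> 'a \<Rightarrow> 'a \<Rightarrow> real" where
  "collapse_twins G d u v = (if twins G d u v then 0 else d u v)"

lemma twins_sym: "twins G d u v \<longleftrightarrow> twins G d v u"
  unfolding twins_def nonadjacency_def
  by (metis (no_types, lifting) case_prod_conv insert_commute mem_Collect_eq)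

lemma twins_refl: "is_graph G \<Longrightarrow> u \<in> verts G \<Longrightarrow> twins G d u u"
  using edgeD(3)[of G u u] unfolding twins_def nonadjacency_def by auto

lemma neighbour_of_nonadjacent:
  assumes G: "is_graph G" and tr: "trans (nonadjacency G)"
    and "(u, v) \<in> nonadjacency G" "{u, x} \<in> edges G"
  shows "{v, x} \<in> edges G"
proof (rule ccontr)
  assume "{v, x} \<notin> edges G"
  then have "(v, x) \<in> nonadjacency G"
    using assms(3) edgeD[OF G assms(4)] by (simp add: nonadjacency_def)
  then have "(u, x) \<in> nonadjacency G" using assms(3) tr by (meson transD)
  then show False using assms(4) by (simp add: nonadjacency_def)
qed

text \<open>
  The value at a pair of vertices that are not twins is dictated by the weight, either
  directly or by the isosceles property at a common neighbour.
\<close>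

lemma extensions_agree_off_twins:
  assumes G: "is_graph G"
    and d: "d \<in> pseudoultrametric_extensions G w" and d': "d' \<in> pseudoultrametric_extensions G w"
    and V: "u \<in> verts G" "v \<in> verts G" and nt: "\<not> twins G d u v"
  shows "d u v = d' u v"
proof (cases "{u, v} \<in> edges G")
  case True
  then show ?thesis
    using d d' unfolding pseudoultrametric_extensions_def extends_weight_def by auto
next
  case False
  then obtain x where x: "{u, x} \<in> edges G" "{v, x} \<in> edges G" "d u x \<noteq> d v x"
    using nt V unfolding twins_def nonadjacency_def by auto
  have xv: "{x, v} \<in> edges G" using x(2) by (simp add: insert_commute)
  have xV: "x \<in> verts G" using edgeD[OF G x(1)] by simp
  have agree: "d u x = d' u x" "d x v = d' x v"
    using d d' x(1) xv unfolding pseudoultrametric_extensions_def extends_weight_def by auto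
  have pd: "pseudoultrametric_on (verts G) d" "pseudoultrametric_on (verts G) d'"
    using d d' unfolding pseudoultrametric_extensions_def by auto
  have "d u x \<noteq> d x v" using x(3) pseudoultrametric_onD(2)[OF pd(1) xV V(2)] by simp
  then show ?thesis
    using isosceles[OF pd(1) V xV] isosceles[OF pd(2) V xV] agree by simp
qed

lemma twins_trans:
  assumes G: "is_graph G" and tr: "trans (nonadjacency G)"
    and uz: "twins G d u z" and zv: "twins G d z v"
  shows "twins G d u v"
  unfolding twins_def
proof (intro conjI allI impI)
  show "(u, v) \<in> nonadjacency G" using uz zv tr unfolding twins_def by (meson transD)
next
  fix x assume x: "{u, x} \<in> edges G" "{v, x} \<in> edges G"
  have "{z, x} \<in> edges G"
    using neighbour_of_nonadjacent[OF G tr _ x(1)] uz unfolding twins_def by blast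
  then show "d u x = d v x" using x uz zv unfolding twins_def by auto
qed

text \<open>
  Twins are interchangeable: the neighbour that forces the value at \<open>u, v\<close> forces the same
  value at \<open>z, v\<close>. Hence collapsing twins is compatible with the strong triangle inequality.
\<close>

lemma twins_interchangeable:
  assumes G: "is_graph G" and tr: "trans (nonadjacency G)"
    and pd: "pseudoultrametric_on (verts G) d"
    and uz: "twins G d u z" and V: "v \<in> verts G" and nt: "\<not> twins G d u v"
  shows "d u v = d z v"
proof (cases "{u, v} \<in> edges G")
  case True
  moreover have "{z, v} \<in> edges G"
    using neighbour_of_nonadjacent[OF G tr _ True] uz unfolding twins_def by blast
  ultimately show ?thesis using uz unfolding twins_def by blast
next
  case False
  have UZ: "u \<in> verts G" "z \<in> verts G" using uz unfolding twins_def nonadjacency_def by auto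
  obtain x where x: "{u, x} \<in> edges G" "{v, x} \<in> edges G" "d u x \<noteq> d v x"
    using nt False V UZ unfolding twins_def nonadjacency_def by auto
  have xV: "x \<in> verts G" using edgeD[OF G x(1)] by simp
  have "{z, x} \<in> edges G"
    using neighbour_of_nonadjacent[OF G tr _ x(1)] uz unfolding twins_def by blast
  then have "d z x = d u x" using uz x unfolding twins_def by auto
  moreover have "d v x = d x v" using pseudoultrametric_onD(2)[OF pd V xV] .
  ultimately show ?thesis
    using isosceles[OF pd UZ(1) V xV] isosceles[OF pd UZ(2) V xV] x(3) by simp
qed

lemma pseudoultrametric_on_collapse:
  assumes G: "is_graph G" and tr: "trans (nonadjacency G)"
    and pd: "pseudoultrametric_on (verts G) d"
  shows "pseudoultrametric_on (verts G) (collapse_twins G d)"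
  unfolding pseudoultrametric_on_def
proof (intro conjI ballI)
  fix x y assume V: "x \<in> verts G" "y \<in> verts G"
  show nonneg: "0 \<le> collapse_twins G d x y"
    using pseudoultrametric_onD(1)[OF pd V] by (simp add: collapse_twins_def)
  show "collapse_twins G d x y = collapse_twins G d y x"
    using pseudoultrametric_onD(2)[OF pd V] twins_sym by (metis collapse_twins_def)
next
  fix x assume "x \<in> verts G"
  then show "collapse_twins G d x x = 0"
    using twins_refl[OF G] by (simp add: collapse_twins_def)
next
  fix x y z assume V: "x \<in> verts G" "y \<in> verts G" "z \<in> verts G"
  show "collapse_twins G d x y \<le> max (collapse_twins G d x z) (collapse_twins G d z y)"
  proof (cases "twins G d x y")
    case True
    then show ?thesis
      using pseudoultrametric_onD(1)[OF pd] V by (auto simp: collapse_twins_def max_def)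
  next
    case nt: False
    consider "\<not> twins G d x z" "\<not> twins G d z y" | "twins G d x z" | "twins G d z y" by blast
    then show ?thesis
    proof cases
      case 1
      then show ?thesis
        using nt pseudoultrametric_onD(4)[OF pd] V by (simp add: collapse_twins_def)
    next
      case 2
      then have "\<not> twins G d z y" using nt twins_trans[OF G tr] by blast
      then show ?thesis
        using nt twins_interchangeable[OF G tr pd 2 V(2) nt] by (simp add: collapse_twins_def)
    next
      case 3
      then have "\<not> twins G d x z" using nt twins_trans[OF G tr] by blast
      moreover have "d y x = d z x"
        using twins_interchangeable[OF G tr pd _ V(1)] 3 nt twins_sym by metis
      ultimately show ?thesis
        using nt pseudoultrametric_onD(2)[OF pd] V by (simp add: collapse_twins_def)
    qed
  qed
qed

lemma least_extension_collapse:
  assumes G: "is_graph G" and tr: "trans (nonadjacency G)"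
    and d: "d \<in> pseudoultrametric_extensions G w"
  shows "is_least_extension G w (collapse_twins G d)"
proof -
  have pd: "pseudoultrametric_on (verts G) d" and ext: "extends_weight G w d"
    using d unfolding pseudoultrametric_extensions_def by auto
  have "extends_weight G w (collapse_twins G d)"
    unfolding extends_weight_def
  proof (intro allI impI)
    fix x y assume xy: "{x, y} \<in> edges G"
    then have "\<not> twins G d x y" by (simp add: twins_def nonadjacency_def)
    moreover have "d x y = w {x, y}" using ext xy unfolding extends_weight_def by blast
    ultimately show "collapse_twins G d x y = w {x, y}" by (simp add: collapse_twins_def)
  qed
  moreover have "collapse_twins G d u v \<le> d' u v"
    if d': "d' \<in> pseudoultrametric_extensions G w" and V: "u \<in> verts G" "v \<in> verts G" for d' u v
  proof -
    have "pseudoultrametric_on (verts G) d'"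
      using d' unfolding pseudoultrametric_extensions_def by simp
    then have "0 \<le> d' u v" using V by (rule pseudoultrametric_onD(1))
    then show ?thesis
      using extensions_agree_off_twins[OF G d d' V] by (auto simp: collapse_twins_def)
  qed
  ultimately show ?thesis
    using pseudoultrametric_on_collapse[OF G tr pd]
    unfolding is_least_extension_def pointwise_le_on_def
    by (auto simp: pseudoultrametric_extensions_def)
qed

section \<open>Twice-max pairs\<close>

text \<open>
  A common neighbour at unequal distances gives a two-edge path with a single maximal edge,
  so a twice-max pair admits no such neighbour.
\<close>

lemma twice_max_twins:
  assumes G: "is_graph G" and d: "d \<in> pseudoultrametric_extensions G w"
    and tm: "{u, v} \<in> twice_max G w"
  shows "twins G d u v"
proof -
  obtain p q where eq: "{u, v} = {p, q}" and pq: "p \<in> verts G" "q \<in> verts G" "p \<noteq> q"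
    "{p, q} \<notin> edges G"
    and paths: "\<forall>P \<in> paths G p q. \<exists>e\<^sub>1 \<in> edges P. \<exists>e\<^sub>2 \<in> edges P.
        e\<^sub>1 \<noteq> e\<^sub>2 \<and> w e\<^sub>1 = max_weight w P \<and> w e\<^sub>2 = max_weight w P"
    using tm unfolding twice_max_def mem_Collect_eq by (elim exE conjE) (rule that; assumption)
  have "twins G d p q"
    unfolding twins_def
  proof (intro conjI allI impI)
    show "(p, q) \<in> nonadjacency G" using pq by (simp add: nonadjacency_def)
  next
    fix x assume x: "{p, x} \<in> edges G" "{q, x} \<in> edges G"
    have swap: "{x, q} = {q, x}" by (rule insert_commute)
    have xq: "{x, q} \<in> edges G" unfolding swap by (rule x(2))
    obtain P where P: "P \<in> paths G p q" "edges P = {{p, x}, {x, q}}"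
      using two_edge_path[OF G x(1) xq pq(1) edgeD(2)[OF G x(1)] pq(2) edgeD(3)[OF G x(1)]
          edgeD(3)[OF G xq] pq(3)] .
    have "w {p, x} = w {x, q}" using bspec[OF paths P(1)] unfolding P(2) by auto
    then have "w {p, x} = w {q, x}" unfolding swap .
    moreover have "d p x = w {p, x}" "d q x = w {q, x}"
      using d x unfolding pseudoultrametric_extensions_def extends_weight_def by blast+
    ultimately show "d p x = d q x" by simp
  qed
  then show ?thesis using eq twins_sym[of G d p q] by (auto simp: doubleton_eq_iff)
qed

lemma single_max_path_exists:
  assumes G: "is_graph G" and V: "u \<in> verts G" "v \<in> verts G" "u \<noteq> v"
    and ntm: "{u, v} \<notin> twice_max G w"
  shows "\<exists>F \<in> paths G u v. max_on_single_edge w F"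
proof (cases "{u, v} \<in> edges G")
  case True
  obtain P where P: "P \<in> paths G u v" "edges P = {{u, v}}"
    using edge_path[OF G True V] .
  have "max_on_single_edge w P"
    unfolding max_on_single_edge_def max_weight_def P(2) by (rule ex1I[of _ "{u, v}"]) auto
  then show ?thesis using P(1) by blast
next
  case False
  have "\<not> (\<forall>P \<in> paths G u v. \<exists>e\<^sub>1 \<in> edges P. \<exists>e\<^sub>2 \<in> edges P.
      e\<^sub>1 \<noteq> e\<^sub>2 \<and> w e\<^sub>1 = max_weight w P \<and> w e\<^sub>2 = max_weight w P)" (is "\<not> ?tm")
  proof
    assume ?tm
    then have "{u, v} \<in> twice_max G w"
      unfolding twice_max_def mem_Collect_eq
      by (intro exI[of _ u] exI[of _ v] conjI V False refl)
    then show False using ntm by contradiction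
  qed
  then obtain P where P: "P \<in> paths G u v"
    and uniq: "\<And>e\<^sub>1 e\<^sub>2. e\<^sub>1 \<in> edges P \<Longrightarrow> e\<^sub>2 \<in> edges P \<Longrightarrow>
      w e\<^sub>1 = max_weight w P \<Longrightarrow> w e\<^sub>2 = max_weight w P \<Longrightarrow> e\<^sub>1 = e\<^sub>2"
    by metis
  have "finite (verts P)" "edges P \<noteq> {}" "is_graph P"
    using P unfolding paths_def connecting_path_def by auto
  then have "finite (edges P)"
    using finite_subset[of "edges P" "Pow (verts P)"] unfolding is_graph_def by auto
  then have "finite (w ` edges P)" "w ` edges P \<noteq> {}"
    using \<open>edges P \<noteq> {}\<close> by auto
  then have "max_weight w P \<in> w ` edges P"
    unfolding max_weight_def by (rule Max_in)
  then obtain e where e: "e \<in> edges P" "w e = max_weight w P" by auto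
  then have "max_on_single_edge w P"
    unfolding max_on_single_edge_def using uniq[OF _ e(1) _ e(2)] by blast
  then show ?thesis using P by blast
qed

section \<open>Characterization and formula\<close>

theorem theorem5p2:
  fixes G :: "'a graph"
  assumes "is_graph G" and "edges G \<noteq> {}"
  shows
    "((\<forall>w. is_weight G w \<and> pseudoultrametrizable G w \<longrightarrow> (\<exists>\<rho>. is_least_extension G w \<rho>)) \<longleftrightarrow>
      (\<exists>k :: 'a set rel. ctwo \<le>o k \<and> complete_partite k G)) \<and>
     ((\<exists>k :: 'a set rel. ctwo \<le>o k \<and> complete_partite k G) \<longrightarrow>
      (\<forall>w \<rho>\<^sub>0. is_weight G w \<and> pseudoultrametrizable G w \<and> is_least_extension G w \<rho>\<^sub>0 \<longrightarrow>
        (\<forall>u \<in> verts G. \<forall>v \<in> verts G. u \<noteq> v \<longrightarrow>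
          ({u, v} \<in> twice_max G w \<longrightarrow> \<rho>\<^sub>0 u v = 0) \<and>
          ({u, v} \<notin> twice_max G w \<longrightarrow>
            (\<exists>F \<in> paths G u v. max_on_single_edge w F) \<and>
            (\<forall>F \<in> paths G u v. max_on_single_edge w F \<longrightarrow> \<rho>\<^sub>0 u v = max_weight w F)))))"
proof -
  let ?least = "\<forall>w. is_weight G w \<and> pseudoultrametrizable G w \<longrightarrow> (\<exists>\<rho>. is_least_extension G w \<rho>)"
  have "?least" if "trans (nonadjacency G)"
    using least_extension_collapse[OF assms(1) that] unfolding pseudoultrametrizable_def by blast
  then have equiv: "?least \<longleftrightarrow> trans (nonadjacency G)"
    using least_imp_nonadjacency_trans[OF assms(1)] by blast
  have zero: "\<rho> u v = 0"
    if tr: "trans (nonadjacency G)" and \<rho>: "is_least_extension G w \<rho>"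
      and V: "u \<in> verts G" "v \<in> verts G" and tm: "{u, v} \<in> twice_max G w" for w \<rho> u v
  proof -
    have ext: "\<rho> \<in> pseudoultrametric_extensions G w"
      using \<rho> unfolding is_least_extension_def by simp
    have "\<rho> u v \<le> collapse_twins G \<rho> u v"
      using least_extension_collapse[OF assms(1) tr ext] \<rho> V
      unfolding is_least_extension_def pointwise_le_on_def by blast
    moreover have "collapse_twins G \<rho> u v = 0"
      using twice_max_twins[OF assms(1) ext tm] by (simp add: collapse_twins_def)
    moreover have "0 \<le> \<rho> u v"
      using ext V by (auto simp: pseudoultrametric_extensions_def pseudoultrametric_onD(1))
    ultimately show ?thesis by simp
  qed
  show ?thesis
    unfolding equiv complete_partite_iff_nonadjacency_trans[OF assms]
  proof (intro conjI impI allI ballI refl)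
    fix w \<rho> u v
    assume tr: "trans (nonadjacency G)"
      and "is_weight G w \<and> pseudoultrametrizable G w \<and> is_least_extension G w \<rho>"
      and V: "u \<in> verts G" "v \<in> verts G" "u \<noteq> v"
    then have \<rho>: "is_least_extension G w \<rho>" by blast
    show "\<rho> u v = 0" if "{u, v} \<in> twice_max G w"
      using zero[OF tr \<rho> V(1,2) that] .
    show "\<exists>F \<in> paths G u v. max_on_single_edge w F" if "{u, v} \<notin> twice_max G w"
      using single_max_path_exists[OF assms(1) V that] .
    show "\<rho> u v = max_weight w F" if "F \<in> paths G u v" "max_on_single_edge w F" for F
      using extension_eq_max_weight[OF _ that] \<rho> unfolding is_least_extension_def by blast
  qed
qed

end
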